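(* Let $G$ be a finite group and let $N$ be a normal subgroup of $G$. Then $n(\Gamma_G^*(N))\leq 2$ and $n(\Gamma_G^*(N))=n(\Gamma_G(N))$.
   Context: For a finite group $G$ and a normal subgroup $N$ of $G$, $\mathrm{Con}_G(N)$ denotes the set of $G$-conjugacy classes $x^G=\{x^g \mid g\in G\}$ of elements $x\in N$. A class $x^G$ is central if $x\in \mathbf{Z}(G)$ (equivalently $|x^G|=1$), and non-central otherwise. The graph $\Gamma_G(N)$ is the simple graph whose vertices are the non-central elements of $\mathrm{Con}_G(N)$, two distinct vertices $x^G$ and $y^G$ being joined by an edge if and only if $|x^G|$ and $|y^G|$ have a common prime divisor. The graph $\Gamma_G^*(N)$ is the simple graph whose vertices are the primes dividing $|C|$ for some $C\in\mathrm{Con}_G(N)$, two distinct vertices $p$ and $q$ being joined by an edge if and only if there exists $C\in \mathrm{Con}_G(N)$ such that $pq$ divides $|C|$. The number of connected components of a graph $\Gamma$ is denoted by $n(\Gamma)$. *)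

theory Defs
  imports
    "HOL-Algebra.Group_Action"
    "HOL-Computational_Algebra.Primes"
    "Graph_Theory.Graph_Theory"
begin

section \<open>Conjugacy classes\<close>

definition conj_class :: "('a, 'b) monoid_scheme \<Rightarrow> 'a \<Rightarrow> 'a set" where
  "conj_class G x = {inv\<^bsub>G\<^esub> g \<otimes>\<^bsub>G\<^esub> x \<otimes>\<^bsub>G\<^esub> g | g. g \<in> carrier G}"

definition Con :: "('a, 'b) monoid_scheme \<Rightarrow> 'a set \<Rightarrow> 'a set set" where
  "Con G N = {conj_class G x | x. x \<in> N}"

definition group_center :: "('a, 'b) monoid_scheme \<Rightarrow> 'a set" where
  "group_center G = {z \<in> carrier G. \<forall>g \<in> carrier G. z \<otimes>\<^bsub>G\<^esub> g = g \<otimes>\<^bsub>G\<^esub> z}"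

definition noncentral_Con :: "('a, 'b) monoid_scheme \<Rightarrow> 'a set \<Rightarrow> 'a set set" where
  "noncentral_Con G N = {conj_class G x | x. x \<in> N \<and> x \<notin> group_center G}"

text \<open>The library's conjugation action is \<open>h \<mapsto> g h g\<inverse>\<close>; its orbits are the same classes.\<close>

lemma (in group) conj_class_eq_orbit:
  assumes "x \<in> carrier G"
  shows "conj_class G x = Group_Action.orbit G (\<lambda>g. \<lambda>h \<in> carrier G. g \<otimes> h \<otimes> inv g) x"
proof -
  have "inv g \<otimes> x \<otimes> g = inv g \<otimes> x \<otimes> inv (inv g)" if "g \<in> carrier G" for g
    using that by simp
  then show ?thesis
    using assms unfolding conj_class_def Group_Action.orbit_def
    by (auto intro: inv_closed) (metis inv_closed inv_inv)+
qed

lemma (in group) conj_class_self: "x \<in> carrier G \<Longrightarrow> x \<in> conj_class G x"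
  unfolding conj_class_def by (force intro: exI[of _ \<one>])

lemma (in group) noncentral_iff_card_ne_1:
  assumes "x \<in> carrier G"
  shows "x \<notin> group_center G \<longleftrightarrow> card (conj_class G x) \<noteq> 1"
proof -
  have "inv g \<otimes> x \<otimes> g = x \<longleftrightarrow> x \<otimes> g = g \<otimes> x" if "g \<in> carrier G" for g
    using that assms by (metis inv_closed inv_solve_left m_assoc m_closed)
  then have "conj_class G x = {x} \<longleftrightarrow> x \<in> group_center G"
    using assms conj_class_self[OF assms]
    unfolding conj_class_def group_center_def by auto
  moreover have "card (conj_class G x) = 1 \<longleftrightarrow> conj_class G x = {x}"
    using conj_class_self[OF assms] by (auto simp: card_1_singleton_iff)
  ultimately show ?thesis by blast
qed


section \<open>The two graphs\<close>

text \<open>A simple graph is represented by a finite loop-free symmetric digraph without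
  parallel arcs (locale \<open>pair_graph\<close>): an edge \<open>{u, v}\<close> is the pair of arcs
  \<open>(u, v)\<close>, \<open>(v, u)\<close>.\<close>

definition class_graph :: "('a, 'b) monoid_scheme \<Rightarrow> 'a set \<Rightarrow> 'a set pair_pre_digraph" where
  "class_graph G N =
     \<lparr> pverts = noncentral_Con G N,
       parcs = {(C, D). C \<in> noncentral_Con G N \<and> D \<in> noncentral_Con G N \<and> C \<noteq> D \<and>
                        (\<exists>p. prime p \<and> p dvd card C \<and> p dvd card D)} \<rparr>"

definition class_primes :: "('a, 'b) monoid_scheme \<Rightarrow> 'a set \<Rightarrow> nat set" where
  "class_primes G N = {p. prime p \<and> (\<exists>C \<in> Con G N. p dvd card C)}"

definition prime_graph :: "('a, 'b) monoid_scheme \<Rightarrow> 'a set \<Rightarrow> nat pair_pre_digraph" where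
  "prime_graph G N =
     \<lparr> pverts = class_primes G N,
       parcs = {(p, q). p \<in> class_primes G N \<and> q \<in> class_primes G N \<and> p \<noteq> q \<and>
                        (\<exists>C \<in> Con G N. p * q dvd card C)} \<rparr>"

lemma (in group) finite_Con:
  assumes "finite (carrier G)" "N \<subseteq> carrier G"
  shows "finite (Con G N)"
  using finite_subset[OF assms(2,1)] by (simp add: Con_def Setcompr_eq_image)

lemma noncentral_Con_subset: "noncentral_Con G N \<subseteq> Con G N"
  by (auto simp: noncentral_Con_def Con_def)

lemma (in group) card_Con_pos:
  assumes "finite (carrier G)" "N \<subseteq> carrier G" "C \<in> Con G N"
  shows "card C > 0"
proof -
  obtain x where x: "x \<in> carrier G" "C = conj_class G x"
    using assms by (auto simp: Con_def)
  have "finite C"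
    using assms(1) x(2) by (simp add: conj_class_def Setcompr_eq_image)
  with conj_class_self[OF x(1)] x(2) show ?thesis by (auto simp: card_gt_0_iff)
qed

lemma (in group) finite_class_primes:
  assumes "finite (carrier G)" "N \<subseteq> carrier G"
  shows "finite (class_primes G N)"
proof -
  have "class_primes G N \<subseteq> (\<Union>C\<in>Con G N. {p. p dvd card C})"
    by (auto simp: class_primes_def)
  moreover have "finite (\<Union>C\<in>Con G N. {p. p dvd card C})"
    using finite_Con[OF assms] card_Con_pos[OF assms] by (auto intro: finite_divisors_nat)
  ultimately show ?thesis by (rule finite_subset)
qed

lemma (in group) pair_graph_class_graph:
  assumes "finite (carrier G)" "N \<subseteq> carrier G"
  shows "pair_graph (class_graph G N)"
proof -
  have fin: "finite (noncentral_Con G N)"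
    using finite_Con[OF assms] noncentral_Con_subset finite_subset by blast
  moreover have "finite (parcs (class_graph G N))"
    by (rule finite_subset[of _ "noncentral_Con G N \<times> noncentral_Con G N"])
       (auto simp: class_graph_def fin)
  ultimately show ?thesis
    by unfold_locales (auto simp: class_graph_def symmetric_def sym_def)
qed

lemma (in group) pair_graph_prime_graph:
  assumes "finite (carrier G)" "N \<subseteq> carrier G"
  shows "pair_graph (prime_graph G N)"
proof -
  have fin: "finite (class_primes G N)"
    using finite_class_primes[OF assms] .
  moreover have "finite (parcs (prime_graph G N))"
    by (rule finite_subset[of _ "class_primes G N \<times> class_primes G N"])
       (auto simp: prime_graph_def fin)
  ultimately show ?thesis
    by unfold_locales (auto simp: prime_graph_def symmetric_def sym_def mult.commute)
qed


section \<open>Connected components\<close>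

text \<open>The empty graph has no connected component, since \<^const>\<open>Digraph_Component.connected\<close>
  requires a vertex.\<close>

definition n_components :: "'v pair_pre_digraph \<Rightarrow> nat" where
  "n_components \<Gamma> =
     card {H. pre_digraph.max_subgraph (with_proj \<Gamma>) Digraph_Component.connected H}"

lemma (in sym_digraph) max_connected_eq_sccs:
  "{H. max_subgraph Digraph_Component.connected H} = sccs"
proof -
  have sc: "strongly_connected (G \<restriction> verts H)"
    if "subgraph H G" "Digraph_Component.connected H" for H
  proof -
    have ind: "induced_subgraph (G \<restriction> verts H) G"
      using that(1) by (intro induced_induce) auto
    then interpret I: wf_digraph "G \<restriction> verts H" by (rule wf_digraphI_induced)
    have "spanning H (G \<restriction> verts H)"
      using subgraph_induce_subgraphI2[OF that(1)] by (simp add: spanning_def)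
    then have "Digraph_Component.connected (G \<restriction> verts H)"
      using that(2) by (rule I.connected_spanning_imp_connected)
    with induced_graph_imp_symmetric[OF sym_arcs ind] show ?thesis
      by (rule I.symmetric_connected_imp_strongly_connected)
  qed
  have conn: "Digraph_Component.connected H"
    if "wf_digraph H" "strongly_connected H" for H :: "('a, 'b) pre_digraph"
    using that by (auto simp: connected_def strongly_connected_def
        intro!: wf_digraph.reachable_mk_symmetricI)
  have ind_sub: "subgraph H (G \<restriction> verts H)" "subgraph (G \<restriction> verts H) G" if "subgraph H G" for H
    using that subgraph_induce_subgraphI2 by (auto intro: subgraph_induce_subgraphI)
  have "max_subgraph strongly_connected H" if "max_subgraph Digraph_Component.connected H" for H
  proof -
    have H: "subgraph H G" "Digraph_Component.connected H"
      using that by (auto simp: max_subgraph_def)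
    have "Digraph_Component.connected (G \<restriction> verts H)"
      using sc[OF H] ind_sub[OF H(1)] by (auto intro: conn)
    then have "G \<restriction> verts H = H"
      using that ind_sub[OF H(1)] by (auto simp: max_subgraph_def)
    then have "strongly_connected H" using sc[OF H] by simp
    then show ?thesis
      using that conn by (auto simp: max_subgraph_def)
  qed
  moreover
  have "max_subgraph Digraph_Component.connected H" if m: "max_subgraph strongly_connected H" for H
  proof (rule max_subgraphI)
    show "subgraph H G" using m by (simp add: max_subgraph_def)
    then show "Digraph_Component.connected H"
      using m by (auto simp: max_subgraph_def intro: conn)
    fix K assume K: "H \<noteq> K" "subgraph H K" "subgraph K G"
    show "\<not> Digraph_Component.connected K"
    proof
      assume "Digraph_Component.connected K"
      then have "strongly_connected (G \<restriction> verts K)" using sc K(3) by blast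
      moreover have "subgraph H (G \<restriction> verts K)"
        using K(2) ind_sub(1)[OF K(3)] by (rule subgraph_trans)
      ultimately have "H = G \<restriction> verts K"
        using m ind_sub(2)[OF K(3)] by (auto simp: max_subgraph_def)
      then have "subgraph K H" using ind_sub(1)[OF K(3)] by simp
      with K(1,2) show False
        by (auto simp: subgraph_def compatible_def)
    qed
  qed
  ultimately show ?thesis by (auto simp: sccs_altdef2)
qed

lemma n_components_eq_card_sccs_verts:
  assumes "pair_sym_digraph \<Gamma>"
  shows "n_components \<Gamma> = card (pre_digraph.sccs_verts (with_proj \<Gamma>))"
proof -
  interpret pair_sym_digraph \<Gamma> by fact
  show ?thesis
    using max_connected_eq_sccs card_sccs_verts by (simp add: n_components_def)
qed

end

theory Submission
  imports Defs
begin

text \<open>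
  The primes and the non-central classes form the two sides of a bipartite graph under ``divides
  the size of'', and both graphs have the same components as this bipartite graph.

  For the bound, if \<open>X\<close> and \<open>Y\<close> are classes of coprime sizes, then \<open>G\<close> is transitive on
  \<open>X \<times> Y\<close>, so \<open>X Y\<close> is a class whose size divides \<open>|X| |Y|\<close>. If moreover \<open>X\<close> and \<open>Y\<close> lie in
  different components and \<open>|X| < |Y|\<close>, then \<open>|X Y|\<close> cannot share primes with both, which forces
  \<open>|X Y| = |Y|\<close>. Hence \<open>x Y = X Y\<close> for all \<open>x \<in> X\<close>, so every quotient of two elements of \<open>X\<close>
  stabilises \<open>Y\<close> under left translation, and the order of this stabiliser divides \<open>|Y|\<close>. Given
  three components, apply this to a smallest class \<open>X\<close> among three representatives
  and to the two others: the stabilisers have coprime orders, so \<open>X\<close> is a singleton.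
\<close>

section \<open>Connected components\<close>

text \<open>When \<open>f\<close> and \<open>g\<close> identify the same pairs, choosing an
  \<open>f\<close>-preimage and applying \<open>g\<close> is a bijection of the images. It serves to
  count components of two graphs over one index set, and conjugates by cosets.\<close>

lemma card_image_eq_of_same_kernel:
  assumes "\<And>x y. x \<in> R \<Longrightarrow> y \<in> R \<Longrightarrow> f x = f y \<longleftrightarrow> g x = g y"
  shows "card (f ` R) = card (g ` R)"
proof -
  let ?h = "\<lambda>s. g (inv_into R f s)"
  have h: "?h (f x) = g x" if "x \<in> R" for x
    using that assms[of "inv_into R f (f x)" x] by (simp add: inv_into_into f_inv_into_f)
  have "inj_on ?h (f ` R)"
    using assms by (auto simp: inj_on_def h)
  moreover have "?h ` f ` R = g ` R"
    using h by (force simp: image_image)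
  ultimately show ?thesis
    by (metis card_image)
qed

lemma (in sym_digraph) reachable_sym: "u \<rightarrow>\<^sup>* v \<Longrightarrow> v \<rightarrow>\<^sup>* u"
  using symmetric_reachable[OF sym_arcs] by blast

lemma (in sym_digraph) scc_of_eq_iff:
  assumes "u \<in> verts G" "v \<in> verts G"
  shows "scc_of u = scc_of v \<longleftrightarrow> u \<rightarrow>\<^sup>* v"
  using assms unfolding scc_of_def
  by (auto dest: reachable_sym intro: reachable_trans)

text \<open>Consecutive vertices of a walk in \<open>A\<close> share an \<open>r\<close>-neighbour,
  and any two \<open>r\<close>-neighbours of one vertex are connected in \<open>B\<close>; chaining
  these connections copies the walk to \<open>B\<close>.\<close>

lemma reachable_transfer:
  assumes A: "wf_digraph A" and B: "wf_digraph B"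
    and total: "\<And>a. a \<in> verts A \<Longrightarrow> \<exists>b. r a b"
    and arc: "\<And>a a'. a \<rightarrow>\<^bsub>A\<^esub> a' \<Longrightarrow> \<exists>b. r a b \<and> r a' b"
    and common: "\<And>a b b'. r a b \<Longrightarrow> r a b' \<Longrightarrow> b \<rightarrow>\<^sup>*\<^bsub>B\<^esub> b'"
    and reach: "a \<rightarrow>\<^sup>*\<^bsub>A\<^esub> a'" and "r a b" "r a' b'"
  shows "b \<rightarrow>\<^sup>*\<^bsub>B\<^esub> b'"
  using reach \<open>r a' b'\<close>
proof (induction arbitrary: b' rule: wf_digraph.reachable_induct[OF A, consumes 1])
  case 1
  then show ?case using common \<open>r a b\<close> by blast
next
  case (2 x y)
  \<comment> \<open>The induction hypothesis at \<open>x\<close> reaches \<open>c\<close>; then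
    \<open>c\<close> and \<open>b'\<close> are both neighbours of \<open>y\<close>.\<close>
  then obtain c where "r x c" "r y c" using arc by blast
  then have "b \<rightarrow>\<^sup>*\<^bsub>B\<^esub> c" "c \<rightarrow>\<^sup>*\<^bsub>B\<^esub> b'"
    using 2 common by blast+
  then show ?case by (rule wf_digraph.reachable_trans[OF B])
qed

text \<open>The pairs related by \<open>r\<close> index the components of both graphs: totality
  makes each indexing surjective, and transferring walks in both directions shows that the two
  identify the same pairs.\<close>

lemma card_sccs_verts_eq_of_bipartite:
  assumes A: "sym_digraph A" and B: "sym_digraph B"
    and r: "\<And>a b. r a b \<Longrightarrow> a \<in> verts A \<and> b \<in> verts B"
    and totalA: "\<And>a. a \<in> verts A \<Longrightarrow> \<exists>b. r a b"
    and totalB: "\<And>b. b \<in> verts B \<Longrightarrow> \<exists>a. r a b"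
    and arcA: "\<And>a a'. a \<rightarrow>\<^bsub>A\<^esub> a' \<Longrightarrow> \<exists>b. r a b \<and> r a' b"
    and arcB: "\<And>b b'. b \<rightarrow>\<^bsub>B\<^esub> b' \<Longrightarrow> \<exists>a. r a b \<and> r a b'"
    and commonA: "\<And>a b b'. r a b \<Longrightarrow> r a b' \<Longrightarrow> b \<rightarrow>\<^sup>*\<^bsub>B\<^esub> b'"
    and commonB: "\<And>a a' b. r a b \<Longrightarrow> r a' b \<Longrightarrow> a \<rightarrow>\<^sup>*\<^bsub>A\<^esub> a'"
  shows "card (pre_digraph.sccs_verts A) = card (pre_digraph.sccs_verts B)"
proof -
  interpret A: sym_digraph A by fact
  interpret B: sym_digraph B by fact
  let ?R = "{(a, b). r a b}"
  have "A.sccs_verts = (\<lambda>(a, b). A.scc_of a) ` ?R"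
  proof -
    have "verts A = {a. \<exists>b. r a b}" using r totalA by blast
    then have "verts A = fst ` ?R" by force
    then show ?thesis by (simp add: A.sccs_verts_conv_scc_of image_image case_prod_unfold)
  qed
  moreover have "B.sccs_verts = (\<lambda>(a, b). B.scc_of b) ` ?R"
  proof -
    have "verts B = {b. \<exists>a. r a b}" using r totalB by blast
    then have "verts B = snd ` ?R" by force
    then show ?thesis by (simp add: B.sccs_verts_conv_scc_of image_image case_prod_unfold)
  qed
  moreover have "A.scc_of a = A.scc_of a' \<longleftrightarrow> B.scc_of b = B.scc_of b'"
    if "r a b" "r a' b'" for a b a' b'
  proof -
    have "a \<rightarrow>\<^sup>*\<^bsub>A\<^esub> a' \<longleftrightarrow> b \<rightarrow>\<^sup>*\<^bsub>B\<^esub> b'"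
    proof
      assume reach: "a \<rightarrow>\<^sup>*\<^bsub>A\<^esub> a'"
      show "b \<rightarrow>\<^sup>*\<^bsub>B\<^esub> b'"
        by (rule reachable_transfer[where r = r, OF A.wf_digraph_axioms B.wf_digraph_axioms
              _ _ _ reach that]) (fact totalA arcA commonA)+
    next
      assume reach: "b \<rightarrow>\<^sup>*\<^bsub>B\<^esub> b'"
      show "a \<rightarrow>\<^sup>*\<^bsub>A\<^esub> a'"
        by (rule reachable_transfer[where r = "\<lambda>b a. r a b",
              OF B.wf_digraph_axioms A.wf_digraph_axioms _ _ _ reach that])
          (fact totalB arcB commonB)+
    qed
    then show ?thesis
      using r that A.scc_of_eq_iff B.scc_of_eq_iff by metis
  qed
  ultimately show ?thesis
    using card_image_eq_of_same_kernel[of ?R "\<lambda>(a, b). A.scc_of a" "\<lambda>(a, b). B.scc_of b"]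
    by (simp add: case_prod_unfold)
qed

lemma (in sym_digraph) card_sccs_verts_le_2I:
  assumes "\<And>u v w. \<lbrakk>u \<in> verts G; v \<in> verts G; w \<in> verts G;
      \<not> u \<rightarrow>\<^sup>* v; \<not> u \<rightarrow>\<^sup>* w; \<not> v \<rightarrow>\<^sup>* w\<rbrakk> \<Longrightarrow> False"
  shows "card sccs_verts \<le> 2"
proof (rule ccontr)
  assume "\<not> card sccs_verts \<le> 2"
  then have "3 \<le> card (scc_of ` verts G)"
    by (simp add: sccs_verts_conv_scc_of)
  then obtain T where T: "T \<subseteq> scc_of ` verts G" "card T = 3"
    by (metis obtain_subset_with_card_n)
  then obtain U V W where UVW: "T = {U, V, W}" "U \<noteq> V" "U \<noteq> W" "V \<noteq> W"
    by (auto simp: card_3_iff)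
  obtain u v w where "u \<in> verts G" "U = scc_of u" "v \<in> verts G" "V = scc_of v"
    "w \<in> verts G" "W = scc_of w"
    using T(1) UVW(1) by (auto simp: image_iff)
  with UVW(2-4) show False
    using assms scc_of_eq_iff by metis
qed

section \<open>Classes of coprime sizes\<close>

definition centralizer :: "('a, 'b) monoid_scheme \<Rightarrow> 'a \<Rightarrow> 'a set" where
  "centralizer G x = {g \<in> carrier G. x \<otimes>\<^bsub>G\<^esub> g = g \<otimes>\<^bsub>G\<^esub> x}"

definition left_stabilizer :: "('a, 'b) monoid_scheme \<Rightarrow> 'a set \<Rightarrow> 'a set" where
  "left_stabilizer G B = {g \<in> carrier G. g <#\<^bsub>G\<^esub> B = B}"

context group
begin

section \<open>Orders and indices of subgroups\<close>

lemma card_subgroup_dvd: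
  assumes "subgroup H G" "subgroup K G" "H \<subseteq> K"
  shows "card H dvd card K"
proof -
  interpret K: group "G\<lparr>carrier := K\<rparr>"
    using assms(2) by (rule subgroup_imp_group)
  have "subgroup H (G\<lparr>carrier := K\<rparr>)"
    using assms by (intro subgroup_incl)
  from K.lagrange[OF this] have "card K = card (rcosets\<^bsub>G\<lparr>carrier := K\<rparr>\<^esub> H) * card H"
    by (simp add: order_def)
  then show ?thesis by (rule dvdI[OF trans[OF _ mult.commute]])
qed

text \<open>Orbit counting without an action: the fibres of \<open>f\<close> are the right cosets of
  \<open>H\<close>, so Lagrange's theorem applies. It is used for the conjugates of one element and
  of a pair.\<close>

lemma card_image_mult_card_kernel:
  assumes "subgroup H G"
    and "\<And>g h. g \<in> carrier G \<Longrightarrow> h \<in> carrier G \<Longrightarrow> f g = f h \<longleftrightarrow> g \<otimes> inv h \<in> H"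
  shows "card (f ` carrier G) * card H = order G"
proof -
  have "H #> g = H #> h \<longleftrightarrow> g \<otimes> inv h \<in> H" if "g \<in> carrier G" "h \<in> carrier G" for g h
    using that assms(1) subgroup.rcos_module[OF assms(1) is_group that(2,1)]
    by (metis rcos_self repr_independence)
  then have "card (f ` carrier G) = card ((\<lambda>g. H #> g) ` carrier G)"
    using assms(2) by (intro card_image_eq_of_same_kernel) simp
  also have "(\<lambda>g. H #> g) ` carrier G = rcosets H"
    by (auto simp: RCOSETS_def)
  finally show ?thesis
    using lagrange[OF assms(1)] by simp
qed

text \<open>\<open>card A\<close> and \<open>card B\<close> stand for the indices of
  \<open>H\<close> and \<open>K\<close>, written as products to avoid division; the quotient is the
  index of \<open>K\<close> in \<open>H\<close>.\<close>

lemma card_image_dvd_card_image: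
  assumes "finite (carrier G)" "subgroup H G" "subgroup K G" "K \<subseteq> H"
    and "card A * card H = order G" "card B * card K = order G"
  shows "card A dvd card B"
proof -
  obtain k where k: "card H = card K * k"
    using card_subgroup_dvd[OF assms(3,2,4)] by (auto elim: dvdE)
  have "card K \<noteq> 0"
    using assms(1,6) by (metis mult_0_right order_gt_0_iff_finite less_irrefl)
  moreover have "(card A * k) * card K = card B * card K"
    using assms(5,6) k by (simp add: mult.commute mult.left_commute)
  ultimately have "card A * k = card B" by simp
  then show ?thesis by (metis dvd_triv_left)
qed

section \<open>Centralizers, class sizes and products of classes\<close>

lemma subgroup_centralizer:
  assumes "x \<in> carrier G"
  shows "subgroup (centralizer G x) G"
proof (rule subgroupI)
  show "centralizer G x \<subseteq> carrier G" "centralizer G x \<noteq> {}"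
    using assms by (auto simp: centralizer_def intro: exI[of _ \<one>])
next
  fix g assume "g \<in> centralizer G x"
  then have g: "g \<in> carrier G" "x \<otimes> g = g \<otimes> x" by (auto simp: centralizer_def)
  then have "x \<otimes> inv g = inv g \<otimes> x"
    using assms by (metis inv_closed inv_solve_left inv_solve_right m_assoc m_closed)
  then show "inv g \<in> centralizer G x" using g by (simp add: centralizer_def)
next
  fix g h assume "g \<in> centralizer G x" "h \<in> centralizer G x"
  then show "g \<otimes> h \<in> centralizer G x"
    using assms by (auto simp: centralizer_def) (metis m_assoc)
qed

lemma conj_eq_iff:
  assumes "x \<in> carrier G" "g \<in> carrier G" "h \<in> carrier G"
  shows "inv g \<otimes> x \<otimes> g = inv h \<otimes> x \<otimes> h \<longleftrightarrow> g \<otimes> inv h \<in> centralizer G x"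
proof -
  have "inv g \<otimes> x \<otimes> g = inv h \<otimes> x \<otimes> h \<longleftrightarrow> x \<otimes> g = g \<otimes> (inv h \<otimes> x \<otimes> h)"
    using assms by (metis inv_closed inv_solve_left m_assoc m_closed)
  also have "\<dots> \<longleftrightarrow> x \<otimes> g = (g \<otimes> inv h \<otimes> x) \<otimes> h"
    using assms by (simp add: m_assoc)
  also have "\<dots> \<longleftrightarrow> x \<otimes> g \<otimes> inv h = g \<otimes> inv h \<otimes> x"
    using assms by (metis inv_closed inv_solve_right m_closed)
  finally show ?thesis
    using assms by (simp add: centralizer_def m_assoc)
qed

lemma conj_class_eq_image: "conj_class G x = (\<lambda>g. inv g \<otimes> x \<otimes> g) ` carrier G"
  by (auto simp: conj_class_def)

lemma conj_class_subset: "x \<in> carrier G \<Longrightarrow> conj_class G x \<subseteq> carrier G"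
  by (auto simp: conj_class_def)

lemma finite_conj_class: "finite (carrier G) \<Longrightarrow> finite (conj_class G x)"
  by (simp add: conj_class_eq_image)

lemma card_conj_class_mult_centralizer:
  assumes "x \<in> carrier G"
  shows "card (conj_class G x) * card (centralizer G x) = order G"
  unfolding conj_class_eq_image
  using assms by (intro card_image_mult_card_kernel subgroup_centralizer conj_eq_iff)

lemma conj_mult:
  assumes "x \<in> carrier G" "y \<in> carrier G" "g \<in> carrier G"
  shows "inv g \<otimes> (x \<otimes> y) \<otimes> g = (inv g \<otimes> x \<otimes> g) \<otimes> (inv g \<otimes> y \<otimes> g)"
  using assms by (simp add: m_assoc inv_solve_left) (metis inv_closed inv_solve_left m_closed)

text \<open>Under simultaneous conjugation the orbit \<open>?P\<close> of \<open>(x, y)\<close> has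
  size the index of \<open>?D\<close>. Both class sizes divide this index, hence by coprimality so
  does their product, and \<open>?P\<close> fills \<open>?X \<times> ?Y\<close>. Since conjugation
  respects products, multiplication maps \<open>?P\<close> onto the class of
  \<open>x \<otimes> y\<close>.\<close>

lemma
  assumes fin: "finite (carrier G)" and x: "x \<in> carrier G" and y: "y \<in> carrier G"
    and cop: "coprime (card (conj_class G x)) (card (conj_class G y))"
  shows conj_class_mult_of_coprime:
      "conj_class G (x \<otimes> y) = (\<lambda>(u, v). u \<otimes> v) ` (conj_class G x \<times> conj_class G y)"
    and card_conj_class_mult_dvd_of_coprime:
      "card (conj_class G (x \<otimes> y)) dvd card (conj_class G x) * card (conj_class G y)"
proof -
  let ?X = "conj_class G x" and ?Y = "conj_class G y"
  let ?f = "\<lambda>g. (inv g \<otimes> x \<otimes> g, inv g \<otimes> y \<otimes> g)"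
  let ?P = "?f ` carrier G" and ?D = "centralizer G x \<inter> centralizer G y"
  note sub = subgroup_centralizer[OF x] subgroup_centralizer[OF y]
  have D: "subgroup ?D G"
    using sub by (rule subgroups_Inter_pair)
  have P: "card ?P * card ?D = order G"
    using D conj_eq_iff x y by (intro card_image_mult_card_kernel) auto
  have "card ?X dvd card ?P" "card ?Y dvd card ?P"
    using card_image_dvd_card_image[OF fin sub(1) D _ card_conj_class_mult_centralizer[OF x] P]
      card_image_dvd_card_image[OF fin sub(2) D _ card_conj_class_mult_centralizer[OF y] P]
    by auto
  then have "card ?X * card ?Y dvd card ?P"
    using cop by (simp add: divides_mult)
  moreover have "card ?P > 0"
    using fin by (auto simp: card_gt_0_iff)
  ultimately have "card (?X \<times> ?Y) \<le> card ?P"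
    by (simp add: dvd_imp_le card_cartesian_product)
  moreover have "?P \<subseteq> ?X \<times> ?Y"
    by (auto simp: conj_class_eq_image)
  ultimately have PXY: "?P = ?X \<times> ?Y"
    using finite_conj_class[OF fin] by (intro card_seteq) auto
  have "conj_class G (x \<otimes> y) = (\<lambda>(u, v). u \<otimes> v) ` ?P"
    using conj_mult[OF x y] by (simp add: conj_class_eq_image image_image)
  then show "conj_class G (x \<otimes> y) = (\<lambda>(u, v). u \<otimes> v) ` (?X \<times> ?Y)"
    by (simp only: PXY)
  have xy: "x \<otimes> y \<in> carrier G" using x y by simp
  \<comment> \<open>What commutes with \<open>x\<close> and \<open>y\<close> commutes with their
    product, so the class of the product has size dividing the index of \<open>?D\<close>.\<close>
  have "?D \<subseteq> centralizer G (x \<otimes> y)"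
    using x y by (auto simp: centralizer_def) (metis m_assoc)
  then have "card (conj_class G (x \<otimes> y)) dvd card ?P"
    using card_image_dvd_card_image[OF fin subgroup_centralizer[OF xy] D _
        card_conj_class_mult_centralizer[OF xy] P] by blast
  then show "card (conj_class G (x \<otimes> y)) dvd card ?X * card ?Y"
    by (simp add: PXY card_cartesian_product)
qed

section \<open>Left stabilizers of subsets\<close>

lemma subgroup_left_stabilizer:
  assumes "B \<subseteq> carrier G"
  shows "subgroup (left_stabilizer G B) G"
proof (rule subgroupI)
  show "left_stabilizer G B \<subseteq> carrier G"
    by (auto simp: left_stabilizer_def)
  show "left_stabilizer G B \<noteq> {}"
    using assms lcos_mult_one by (auto simp: left_stabilizer_def)
next
  fix g assume "g \<in> left_stabilizer G B"
  then have g: "g \<in> carrier G" "g <# B = B" by (auto simp: left_stabilizer_def)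
  then have "inv g <# B = B"
    using assms by (metis inv_closed l_inv lcos_m_assoc lcos_mult_one)
  then show "inv g \<in> left_stabilizer G B" using g by (simp add: left_stabilizer_def)
next
  fix g h assume "g \<in> left_stabilizer G B" "h \<in> left_stabilizer G B"
  then show "g \<otimes> h \<in> left_stabilizer G B"
    using assms by (auto simp: left_stabilizer_def simp flip: lcos_m_assoc)
qed

text \<open>\<open>B\<close> is closed under left multiplication by its stabilizer, so it is a
  disjoint union of right cosets, all of the same size.\<close>

lemma card_left_stabilizer_dvd:
  assumes fin: "finite (carrier G)" and B: "B \<subseteq> carrier G"
  shows "card (left_stabilizer G B) dvd card B"
proof -
  let ?S = "left_stabilizer G B"
  let ?C = "(\<lambda>b. ?S #> b) ` B"
  have S: "subgroup ?S G" using B by (rule subgroup_left_stabilizer)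
  have C: "?C \<subseteq> rcosets ?S" using B by (auto simp: RCOSETS_def)
  have "\<Union>?C = B"
    using B rcos_self[OF _ S] by (fastforce simp: left_stabilizer_def r_coset_def l_coset_def)
  moreover have "card ?S * card ?C = card (\<Union>?C)"
  proof (rule card_partition)
    show "finite ?C" "finite (\<Union>?C)"
      using fin B \<open>\<Union>?C = B\<close> by (auto intro: finite_subset)
    show "card c = card ?S" if "c \<in> ?C" for c
      using that C card_rcosets_equal subgroup.subset[OF S] by auto
    show "c \<inter> d = {}" if "c \<in> ?C" "d \<in> ?C" "c \<noteq> d" for c d
      using that C rcos_disjoint[OF S] by (auto simp: pairwise_def disjnt_def)
  qed
  ultimately show ?thesis by (metis dvd_triv_left)
qed

text \<open>\<open>sep\<close> records that the product class shares a prime with at most one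
  factor, as happens when the factors lie in different components.\<close>

lemma quotient_mem_left_stabilizer:
  assumes fin: "finite (carrier G)" and x: "x \<in> carrier G" and y: "y \<in> carrier G"
    and cop: "coprime (card (conj_class G x)) (card (conj_class G y))"
    and less: "card (conj_class G x) < card (conj_class G y)"
    and sep: "coprime (card (conj_class G (x \<otimes> y))) (card (conj_class G x)) \<or>
      coprime (card (conj_class G (x \<otimes> y))) (card (conj_class G y))"
    and u: "u \<in> conj_class G x" "u' \<in> conj_class G x"
  shows "inv u \<otimes> u' \<in> left_stabilizer G (conj_class G y)"
proof -
  let ?X = "conj_class G x" and ?Y = "conj_class G y" and ?E = "conj_class G (x \<otimes> y)"
  have finE: "finite ?E" using fin by (rule finite_conj_class)
  have Y: "?Y \<subseteq> carrier G" using y by (rule conj_class_subset)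
  have uc: "u \<in> carrier G" "u' \<in> carrier G" using u conj_class_subset[OF x] by auto
  have sub: "v <# ?Y \<subseteq> ?E" if "v \<in> ?X" for v
    using that by (auto simp: conj_class_mult_of_coprime[OF fin x y cop] l_coset_def)
  have card_translate: "card (v <# ?Y) = card ?Y" if "v \<in> carrier G" for v
  proof -
    have "v <# ?Y = (\<lambda>b. v \<otimes> b) ` ?Y" by (auto simp: l_coset_def)
    moreover have "inj_on (\<lambda>b. v \<otimes> b) ?Y"
      using Y that by (intro inj_onI) (metis Units_eq Units_l_cancel subsetD)
    ultimately show ?thesis by (simp add: card_image)
  qed
  have ge: "card ?Y \<le> card ?E"
    using card_mono[OF finE sub[OF u(1)]] card_translate[OF uc(1)] by simp
  have dvd: "card ?E dvd card ?X * card ?Y"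
    by (rule card_conj_class_mult_dvd_of_coprime[OF fin x y cop])
  have "?X \<noteq> {}" "?Y \<noteq> {}" using conj_class_self x y by auto
  then have pos: "card ?X > 0" "card ?Y > 0"
    using finite_conj_class[OF fin] by (simp_all add: card_gt_0_iff)
  \<comment> \<open>Otherwise \<open>card ?E\<close> would divide \<open>card ?X\<close>, although
    \<open>?E\<close> contains a translate of the larger \<open>?Y\<close>.\<close>
  have "\<not> coprime (card ?E) (card ?Y)"
  proof
    assume "coprime (card ?E) (card ?Y)"
    then have "card ?E dvd card ?X"
      using dvd coprime_dvd_mult_left_iff by blast
    then show False using dvd_imp_le[OF _ pos(1)] ge less by (metis leD order_trans)
  qed
  with sep dvd have "card ?E dvd card ?Y"
    using coprime_dvd_mult_right_iff by blast
  then have "card ?E = card ?Y"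
    using dvd_imp_le[OF _ pos(2)] ge by (intro le_antisym)
  \<comment> \<open>Each translate lies in \<open>?E\<close> and now has its full size, so all
    translates coincide.\<close>
  then have "v <# ?Y = ?E" if "v \<in> ?X" for v
    using that sub finE card_translate conj_class_subset[OF x] by (intro card_subset_eq) auto
  then have "u' <# ?Y = u <# ?Y" using u by simp
  then have "(inv u \<otimes> u') <# ?Y = ?Y"
    using uc Y by (metis inv_closed l_inv lcos_m_assoc lcos_mult_one)
  then show ?thesis
    using uc by (simp add: left_stabilizer_def)
qed

text \<open>The order of the intersection divides the orders of both stabilizers, hence the coprime
  numbers \<open>card B\<close> and \<open>card C\<close>.\<close>

lemma left_stabilizers_Int_trivial:
  assumes "finite (carrier G)" "B \<subseteq> carrier G" "C \<subseteq> carrier G" "coprime (card B) (card C)"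
  shows "left_stabilizer G B \<inter> left_stabilizer G C = {\<one>}"
proof -
  let ?I = "left_stabilizer G B \<inter> left_stabilizer G C"
  note sub = subgroup_left_stabilizer[OF assms(2)] subgroup_left_stabilizer[OF assms(3)]
  have I: "subgroup ?I G" using sub by (rule subgroups_Inter_pair)
  have "card ?I dvd card B" "card ?I dvd card C"
    using card_subgroup_dvd[OF I sub(1)] card_subgroup_dvd[OF I sub(2)]
      card_left_stabilizer_dvd assms(1-3) by (auto intro: dvd_trans)
  then have "card ?I = 1"
    using assms(4) coprime_common_divisor_nat by blast
  then show ?thesis
    using subgroup.one_closed[OF I] by (metis card_1_singletonE singletonD)
qed

section \<open>Divisibility and reachability in the two graphs\<close>

lemma in_noncentral_Con_iff:
  assumes "N \<subseteq> carrier G"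
  shows "C \<in> noncentral_Con G N \<longleftrightarrow> C \<in> Con G N \<and> card C \<noteq> 1"
  using assms noncentral_iff_card_ne_1 unfolding noncentral_Con_def Con_def by blast

lemma noncentral_ConI:
  assumes "N \<subseteq> carrier G" "C \<in> Con G N" "prime p" "p dvd card C"
  shows "C \<in> noncentral_Con G N"
  using assms by (auto simp: in_noncentral_Con_iff)

text \<open>Reachability replaces adjacency so that \<open>C = D\<close> is covered in a loop-free
  graph; the prime \<open>p\<close> guarantees that both classes are vertices.\<close>

lemma class_graph_reachableI:
  assumes "finite (carrier G)" "N \<subseteq> carrier G" "C \<in> Con G N" "D \<in> Con G N"
    and "prime p" "p dvd card C" "p dvd card D"
  shows "C \<rightarrow>\<^sup>*\<^bsub>with_proj (class_graph G N)\<^esub> D"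
proof -
  interpret pair_graph "class_graph G N" using assms(1,2) by (rule pair_graph_class_graph)
  have CD: "C \<in> noncentral_Con G N" "D \<in> noncentral_Con G N"
    using assms noncentral_ConI by blast+
  show ?thesis
  proof (cases "C = D")
    case True
    have "C \<in> pverts (class_graph G N)"
      using CD by (simp add: class_graph_def)
    then show ?thesis using True reachable_refl by simp
  next
    case False
    then have "(C, D) \<in> parcs (class_graph G N)"
      using CD assms by (auto simp: class_graph_def)
    then show ?thesis by (intro reachable_adjI) auto
  qed
qed

lemma prime_graph_reachableI:
  assumes "finite (carrier G)" "N \<subseteq> carrier G" "C \<in> Con G N"
    and "prime p" "prime q" "p dvd card C" "q dvd card C"
  shows "p \<rightarrow>\<^sup>*\<^bsub>with_proj (prime_graph G N)\<^esub> q"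
proof -
  interpret pair_graph "prime_graph G N" using assms(1,2) by (rule pair_graph_prime_graph)
  have pq: "p \<in> class_primes G N" "q \<in> class_primes G N"
    using assms by (auto simp: class_primes_def)
  show ?thesis
  proof (cases "p = q")
    case True
    have "p \<in> pverts (prime_graph G N)"
      using pq by (simp add: prime_graph_def)
    then show ?thesis using True reachable_refl by simp
  next
    case False
    then have "p * q dvd card C"
      using assms by (simp add: divides_mult primes_coprime)
    then have "(p, q) \<in> parcs (prime_graph G N)"
      using pq assms False by (auto simp: prime_graph_def)
    then show ?thesis by (intro reachable_adjI) auto
  qed
qed

lemma n_components_prime_graph_eq:
  assumes "finite (carrier G)" "N \<subseteq> carrier G"
  shows "n_components (prime_graph G N) = n_components (class_graph G N)"
proof -
  interpret P: pair_graph "prime_graph G N" using assms by (rule pair_graph_prime_graph)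
  interpret C: pair_graph "class_graph G N" using assms by (rule pair_graph_class_graph)
  \<comment> \<open>The relation may range over all of \<open>Con G N\<close>: a class with a prime
    divisor has size other than 1, hence is a vertex.\<close>
  let ?r = "\<lambda>p C. prime p \<and> C \<in> Con G N \<and> p dvd card C"
  have arc: "(u, v) \<in> parcs \<Gamma>" if "u \<rightarrow>\<^bsub>with_proj \<Gamma>\<^esub> v" for \<Gamma> :: "'v pair_pre_digraph" and u v
    using that by (auto simp: arcs_ends_def arc_to_ends_def)
  have "card P.sccs_verts = card C.sccs_verts"
  proof (rule card_sccs_verts_eq_of_bipartite[of _ _ ?r])
    show "sym_digraph (with_proj (prime_graph G N))" "sym_digraph (with_proj (class_graph G N))"
      by unfold_locales
    show "p \<in> verts (with_proj (prime_graph G N)) \<and> C \<in> verts (with_proj (class_graph G N))" if "?r p C" for p C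
      using that noncentral_ConI[OF assms(2)]
      by (auto simp: prime_graph_def class_graph_def class_primes_def)
    show "\<exists>C. ?r p C" if "p \<in> verts (with_proj (prime_graph G N))" for p
      using that by (auto simp: prime_graph_def class_primes_def)
    show "\<exists>p. ?r p C" if "C \<in> verts (with_proj (class_graph G N))" for C
      using that prime_factor_nat[of "card C"]
      by (auto simp: class_graph_def in_noncentral_Con_iff[OF assms(2)])
    show "\<exists>C. ?r p C \<and> ?r q C" if "p \<rightarrow>\<^bsub>with_proj (prime_graph G N)\<^esub> q" for p q
      using arc[OF that] by (auto simp: prime_graph_def class_primes_def dest: dvd_mult_left dvd_mult_right)
    show "\<exists>p. ?r p C \<and> ?r p D" if "C \<rightarrow>\<^bsub>with_proj (class_graph G N)\<^esub> D" for C D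
      using arc[OF that] noncentral_Con_subset[of G N] by (auto simp: class_graph_def)
    show "C \<rightarrow>\<^sup>*\<^bsub>with_proj (class_graph G N)\<^esub> D" if "?r p C" "?r p D" for p C D
      using that assms class_graph_reachableI by blast
    show "p \<rightarrow>\<^sup>*\<^bsub>with_proj (prime_graph G N)\<^esub> q" if "?r p C" "?r q C" for p q C
      using that assms prime_graph_reachableI by blast
  qed
  then show ?thesis
    by (simp add: n_components_eq_card_sccs_verts P.pair_sym_digraph_axioms
        C.pair_sym_digraph_axioms)
qed

text \<open>Minimality of \<open>C\<close> allows the quotient argument against both
  \<open>D\<close> and \<open>E\<close>; their coprime sizes then collapse \<open>C\<close> to a
  point.\<close>

lemma class_graph_no_three_components:
  assumes fin: "finite (carrier G)" and N: "subgroup N G"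
    and C: "C \<in> noncentral_Con G N" "D \<in> noncentral_Con G N" "E \<in> noncentral_Con G N"
    and sep: "\<not> C \<rightarrow>\<^sup>*\<^bsub>with_proj (class_graph G N)\<^esub> D" "\<not> C \<rightarrow>\<^sup>*\<^bsub>with_proj (class_graph G N)\<^esub> E"
      "\<not> D \<rightarrow>\<^sup>*\<^bsub>with_proj (class_graph G N)\<^esub> E"
    and le: "card C \<le> card D" "card C \<le> card E"
  shows False
proof -
  interpret CG: pair_graph "class_graph G N"
    using fin subgroup.subset[OF N] by (rule pair_graph_class_graph)
  have NG: "N \<subseteq> carrier G" using N by (rule subgroup.subset)
  have Con: "C \<in> Con G N" "D \<in> Con G N" "E \<in> Con G N"
    using C noncentral_Con_subset by blast+
  \<comment> \<open>This covers central classes too, since the product class used below is not known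
    to be a vertex.\<close>
  have cop: "coprime (card A) (card B)"
    if "A \<in> Con G N" "B \<in> Con G N" "\<not> A \<rightarrow>\<^sup>*\<^bsub>with_proj (class_graph G N)\<^esub> B" for A B
  proof (rule ccontr)
    assume "\<not> coprime (card A) (card B)"
    then obtain p where "prime p" "p dvd gcd (card A) (card B)"
      using prime_factor_nat[of "gcd (card A) (card B)"] by (auto simp: coprime_iff_gcd_eq_1)
    then show False
      using that class_graph_reachableI[OF fin NG that(1,2)] by auto
  qed
  obtain x where x: "x \<in> N" "C = conj_class G x" using Con(1) by (auto simp: Con_def)
  have quot: "inv u \<otimes> u' \<in> left_stabilizer G B"
    if B: "B \<in> Con G N" and nr: "\<not> C \<rightarrow>\<^sup>*\<^bsub>with_proj (class_graph G N)\<^esub> B"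
      and le: "card C \<le> card B" and u: "u \<in> C" "u' \<in> C" for B u u'
  proof -
    obtain y where y: "y \<in> N" "B = conj_class G y" using B by (auto simp: Con_def)
    have cc: "coprime (card C) (card B)" using cop Con(1) B nr by blast
    have "card C \<noteq> 1" using C(1) in_noncentral_Con_iff[OF NG] by blast
    \<comment> \<open>Coprime equal sizes would both be 1; this makes the inequality strict.\<close>
    with cc have "card C \<noteq> card B" by auto
    with le have less: "card C < card B" by simp
    let ?F = "conj_class G (x \<otimes> y)"
    have F: "?F \<in> Con G N"
      using x y subgroup.m_closed[OF N] by (auto simp: Con_def)
    \<comment> \<open>A product class connected to both would join \<open>C\<close> to
      \<open>B\<close>.\<close>
    have "\<not> ?F \<rightarrow>\<^sup>*\<^bsub>with_proj (class_graph G N)\<^esub> C \<or> \<not> ?F \<rightarrow>\<^sup>*\<^bsub>with_proj (class_graph G N)\<^esub> B"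
      using nr CG.reachable_sym CG.reachable_trans by blast
    then have "coprime (card ?F) (card C) \<or> coprime (card ?F) (card B)"
      using cop F B Con(1) by blast
    then show ?thesis
      using quotient_mem_left_stabilizer[of x y u u'] fin cc less u x y NG by auto
  qed
  have cDE: "coprime (card D) (card E)" using cop Con sep(3) by blast
  have DE: "D \<subseteq> carrier G" "E \<subseteq> carrier G"
    using Con NG conj_class_subset by (auto simp: Con_def)
  have "u = u'" if u: "u \<in> C" "u' \<in> C" for u u'
  proof -
    have "u \<in> carrier G" "u' \<in> carrier G"
      using u x NG conj_class_subset by blast+
    moreover have "inv u \<otimes> u' = \<one>"
      using left_stabilizers_Int_trivial[OF fin DE cDE] quot[OF Con(2) sep(1) le(1) u]
        quot[OF Con(3) sep(2) le(2) u] by blast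
    ultimately show ?thesis
      by (metis inv_closed inv_equality inv_inv)
  qed
  moreover have "x \<in> C" using x NG conj_class_self by blast
  ultimately have "C = {x}" by blast
  then show False
    using C(1) in_noncentral_Con_iff[OF NG] by auto
qed

lemma n_components_class_graph_le_2:
  assumes fin: "finite (carrier G)" and N: "subgroup N G"
  shows "n_components (class_graph G N) \<le> 2"
proof -
  have NG: "N \<subseteq> carrier G" using N by (rule subgroup.subset)
  interpret CG: pair_graph "class_graph G N"
    using fin NG by (rule pair_graph_class_graph)
  let ?R = "\<lambda>C D. C \<rightarrow>\<^sup>*\<^bsub>with_proj (class_graph G N)\<^esub> D"
  have verts: "pverts (class_graph G N) = noncentral_Con G N"
    by (simp add: class_graph_def)
  have "card CG.sccs_verts \<le> 2"
  proof (rule CG.card_sccs_verts_le_2I)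
    fix C D E
    assume *: "C \<in> pverts (class_graph G N)" "D \<in> pverts (class_graph G N)"
      "E \<in> pverts (class_graph G N)" "\<not> ?R C D" "\<not> ?R C E" "\<not> ?R D E"
    \<comment> \<open>Any of the three classes may be the smallest, so separation is needed in both
      directions.\<close>
    then have "\<not> ?R D C" "\<not> ?R E C" "\<not> ?R E D"
      using CG.reachable_sym by blast+
    moreover have "card C \<le> card D \<and> card C \<le> card E \<or> card D \<le> card C \<and> card D \<le> card E \<or>
      card E \<le> card C \<and> card E \<le> card D"
      by linarith
    ultimately show False
      using * class_graph_no_three_components[OF fin N] by (simp add: verts) metis
  qed
  then show ?thesis
    by (simp add: n_components_eq_card_sccs_verts CG.pair_sym_digraph_axioms)
qed

end

theorem theoremC:
  fixes G :: "('a, 'b) monoid_scheme" and N :: "'a set"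
  assumes "group G" and "finite (carrier G)" and "N \<lhd> G"
  shows "n_components (prime_graph G N) \<le> 2 \<and>
         n_components (prime_graph G N) = n_components (class_graph G N)"
proof -
  interpret group G by fact
  have "subgroup N G" using assms(3) by (rule normal_imp_subgroup)
  \<comment> \<open>The bound for the class graph passes to the prime graph through equality of the
    component counts.\<close>
  then show ?thesis
    using assms(2) n_components_prime_graph_eq n_components_class_graph_le_2 subgroup.subset
    by metis
qed

end
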